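(* Let $f\in\mathcal{F}$. $\mathcal{SA}_f$ is a canonical scattering algorithm, which scatters $n$ robots in $O(f(n))$ rounds in expectation.
   Context: Setting: $n$ anonymous, oblivious, disoriented robots modeled as points in the plane, with unlimited visibility, operating in Look-Compute-Move cycles in the fully synchronous (FSYNC) model (the result also holds in SSYNC); no multiplicity detection is used. Time is measured in rounds (each robot executes its cycle at least once per round). A configuration $C$ is the multiset of robot positions and $U(C)$ is the corresponding set of distinct positions. Scattering means that eventually no two robots share a location. A canonical scattering algorithm is one in which each robot observes the configuration $C$ and its position $P$, computes a set $Pos$ of $k_\mathcal{A}(C,P)$ possible destinations such that no point of $Pos$ may be chosen by a robot not currently at $P$, and moves toward a point of $Pos$ chosen uniformly at random. Let $\mathcal{F}=\{f:\mathbb{N}\to\mathbb{N}\mid f \text{ increasing and surjective}\}$, and for $f\in\mathcal{F}$ let $f^{-1}(y)=\max\{x : f(x)=y\}$. Let $\mathcal{N}$ be a constant such that for all $m>\mathcal{N}$ and all $k\le 8m^3$, when $m$ robots are distributed uniformly at random among $k$ destinations, the probability that some destination receives more than $\frac{m}{k}(1+k^{3/4})$ robots is at most $\frac{1}{2k}$ (such an $\mathcal{N}$ exists). Algorithm $\mathcal{SA}_f$, executed by a robot $r$: compute the Voronoi diagram of the observed configuration $C$; let $u=|U(C)|$ and $x=f^{-1}(f(u)+1)$; let $k=\max(8\mathcal{N}^3,16x^4,u^3)$; let $Pos$ be a set of $k$ distinct positions in the Voronoi cell of $r$; move toward a position of $Pos$ chosen uniformly at random. *)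

theory Defs
  imports "HOL-Probability.Probability" "HOL-Library.Landau_Symbols"
begin

type_synonym point = "real ^ 2"

text \<open>
  Entry \<open>i\<close> of a list is the position of robot \<open>i\<close>. The indices serve the analysis only: robots
  are anonymous and an algorithm is given nothing but the multiset of positions.
\<close>
type_synonym positions = "point list"

text \<open>
  An algorithm maps an observed configuration and the observing robot's own position, both in the
  local coordinates of that robot, to its set of possible destinations, in the same coordinates.
  Obliviousness and anonymity are built in: there are no further arguments.
\<close>
type_synonym algorithm = "point multiset \<Rightarrow> point \<Rightarrow> point set"

text \<open>
  Disorientation: a local coordinate system is an arbitrary similarity of the plane (origin,
  direction, unit of length and handedness are all unconstrained).
\<close>
definition frame :: "(point \<Rightarrow> point) \<Rightarrow> bool" where
  "frame \<phi> \<longleftrightarrow> bij \<phi> \<and> (\<exists>r>0. \<forall>x y. dist (\<phi> x) (\<phi> y) = r * dist x y)"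

text \<open>Destinations, in global coordinates, of a robot at \<open>P\<close> whose coordinate system is \<open>\<phi>\<close>.\<close>
definition destinations ::
    "algorithm \<Rightarrow> (point \<Rightarrow> point) \<Rightarrow> point multiset \<Rightarrow> point \<Rightarrow> point set" where
  "destinations A \<phi> C P = inv \<phi> ` A (image_mset \<phi> C) (\<phi> P)"

text \<open>
  The number \<open>k C P\<close> of destinations may not depend on the coordinate system, although the
  destinations themselves may.
\<close>
definition canonical :: "algorithm \<Rightarrow> bool" where
  "canonical A \<longleftrightarrow>
     (\<exists>k. \<forall>C P \<phi>. P \<in># C \<longrightarrow> frame \<phi> \<longrightarrow>
        0 < k C P \<and> finite (destinations A \<phi> C P) \<and> card (destinations A \<phi> C P) = k C P) \<and>
     (\<forall>C P Q \<phi> \<psi>. P \<in># C \<longrightarrow> Q \<in># C \<longrightarrow> P \<noteq> Q \<longrightarrow> frame \<phi> \<longrightarrow> frame \<psi> \<longrightarrow>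
        destinations A \<phi> C P \<inter> destinations A \<psi> C Q = {})"

text \<open>
  One round: all robots look at the same positions \<open>c\<close>, and each of them, independently of the
  others, draws a destination uniformly and reaches it. Robot \<open>i\<close> uses the coordinate system
  \<open>\<Phi> i\<close>.
\<close>
definition round_pmf :: "algorithm \<Rightarrow> (nat \<Rightarrow> point \<Rightarrow> point) \<Rightarrow> positions \<Rightarrow> positions pmf" where
  "round_pmf A \<Phi> c =
     map_pmf (\<lambda>d. map d [0..<length c])
       (Pi_pmf {..<length c} undefined
          (\<lambda>i. pmf_of_set (destinations A (\<Phi> i) (mset c) (c ! i))))"

text \<open>
  The coordinate systems are picked by an adversary that knows the history so far, hence they may
  differ between robots and change from round to round: \<open>F h i\<close> is the coordinate system of robot
  \<open>i\<close> in the round that follows the history \<open>h\<close> (the positions at times \<open>0, \<dots>, length h - 1\<close>).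
\<close>
type_synonym adversary = "positions list \<Rightarrow> nat \<Rightarrow> point \<Rightarrow> point"

definition admissible :: "adversary \<Rightarrow> bool" where
  "admissible F \<longleftrightarrow> (\<forall>h i. frame (F h i))"

primrec history_pmf :: "algorithm \<Rightarrow> adversary \<Rightarrow> positions \<Rightarrow> nat \<Rightarrow> positions list pmf" where
  "history_pmf A F c\<^sub>0 0 = return_pmf [c\<^sub>0]"
| "history_pmf A F c\<^sub>0 (Suc t) =
     bind_pmf (history_pmf A F c\<^sub>0 t)
       (\<lambda>h. map_pmf (\<lambda>c. h @ [c]) (round_pmf A (F h) (last h)))"

text \<open>
  The law, on infinite trajectories, of the execution from \<open>c\<^sub>0\<close>. It is determined by its finite
  histories, which are discrete; \<open>execution_law_exists\<close> below shows that there always is one.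
\<close>
definition execution_law ::
    "algorithm \<Rightarrow> adversary \<Rightarrow> positions \<Rightarrow> (nat \<Rightarrow> positions) measure \<Rightarrow> bool" where
  "execution_law A F c\<^sub>0 M \<longleftrightarrow>
     prob_space M \<and>
     sets M = sets (\<Pi>\<^sub>M t\<in>UNIV. count_space UNIV) \<and>
     (\<forall>t h. length h = Suc t \<longrightarrow>
        measure M {\<omega> \<in> space M. map \<omega> [0..<Suc t] = h} = pmf (history_pmf A F c\<^sub>0 t) h)"

lemma execution_law_exists: "\<exists>M. execution_law A F c\<^sub>0 M"
proof -
  define p where "p h = round_pmf A (F h) (last h)" for h
  define K where "K h = restrict_space (measure_pmf (p h)) (set_pmf (p h))" for h
  have space_K: "space (K h) = set_pmf (p h)" for h
    by (simp add: K_def space_restrict_space)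
  have K_single: "{c} \<inter> set_pmf (p h) \<in> sets (K h)" for c h
    by (auto simp: K_def sets_restrict_space)
  have emeasure_K: "emeasure (K h) ({c} \<inter> set_pmf (p h)) = ennreal (pmf (p h) c)" for c h
    by (subst K_def, subst emeasure_restrict_space)
       (auto simp: emeasure_Int_set_pmf emeasure_pmf_single)
  have prob_K: "prob_space (K h)" for h
    unfolding K_def by (intro prob_space_restrict_space measure_pmf.emeasure_eq_1_AE)
                       (auto simp: AE_measure_pmf)
  interpret product_prob_space K UNIV
    using prob_K by (simp add: product_prob_spaceI)
  define \<Omega> where "\<Omega> = PiM UNIV K"
  define H where "H \<omega> = rec_nat [c\<^sub>0] (\<lambda>_ h. h @ [\<omega> h])" for \<omega> :: "positions list \<Rightarrow> positions"
  have H_0: "H \<omega> 0 = [c\<^sub>0]" and H_Suc: "H \<omega> (Suc t) = H \<omega> t @ [\<omega> (H \<omega> t)]" for \<omega> t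
    by (simp_all add: H_def)
  have length_H: "length (H \<omega> t) = Suc t" for \<omega> t
    by (induction t) (simp_all add: H_0 H_Suc)
  have map_H: "map (\<lambda>t. last (H \<omega> t)) [0..<Suc t] = H \<omega> t" for \<omega> t
    by (induction t) (simp_all add: H_0 H_Suc)
  have H_eq: "H \<omega> t = h \<longleftrightarrow> hd h = c\<^sub>0 \<and> (\<forall>s<t. \<omega> (take (Suc s) h) = h ! Suc s)"
    if "length h = Suc t" for \<omega> t h
    using that
  proof (induction t arbitrary: h)
    case 0
    then show ?case by (cases h) (auto simp: H_0)
  next
    case (Suc t)
    obtain h' c where h: "h = h' @ [c]" and l: "length h' = Suc t"
      using Suc.prems by (metis length_Suc_conv_rev)
    then have "hd h = hd h'" by (cases h') auto
    have "H \<omega> (Suc t) = h \<longleftrightarrow> H \<omega> t = h' \<and> \<omega> h' = c"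
      by (auto simp: H_Suc h)
    moreover have "H \<omega> t = h' \<longleftrightarrow> hd h = c\<^sub>0 \<and> (\<forall>s<t. \<omega> (take (Suc s) h') = h' ! Suc s)"
      using Suc.IH[OF l] \<open>hd h = hd h'\<close> by simp
    moreover have "(\<forall>s<Suc t. \<omega> (take (Suc s) h) = h ! Suc s) \<longleftrightarrow>
        (\<forall>s<t. \<omega> (take (Suc s) h') = h' ! Suc s) \<and> \<omega> h' = c"
      using l by (simp add: h nth_append All_less_Suc conj_commute)
    ultimately show ?case by (simp only: conj_assoc)
  qed
  have pmf_H: "pmf (history_pmf A F c\<^sub>0 t) h =
      (if hd h = c\<^sub>0 then \<Prod>s<t. pmf (p (take (Suc s) h)) (h ! Suc s) else 0)"
    if "length h = Suc t" for t h
    using that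
  proof (induction t arbitrary: h)
    case 0
    then show ?case by (cases h) (auto simp: indicator_def)
  next
    case (Suc t)
    obtain h' c where h: "h = h' @ [c]" and l: "length h' = Suc t"
      using Suc.prems by (metis length_Suc_conv_rev)
    then have hd: "hd h = hd h'" by (cases h') auto
    have eq: "pmf (map_pmf (\<lambda>c. g @ [c]) (p g)) h = indicator {h'} g * pmf (p h') c" for g
    proof (cases "g = h'")
      case True
      have "inj (\<lambda>c. h' @ [c])" by (auto simp: inj_def)
      then show ?thesis using True pmf_map_inj'[of "\<lambda>c. h' @ [c]" "p h'" c] by (simp add: h)
    next
      case False
      then show ?thesis by (auto simp: h pmf_eq_0_set_pmf)
    qed
    have "pmf (history_pmf A F c\<^sub>0 (Suc t)) h =
        measure_pmf.expectation (history_pmf A F c\<^sub>0 t) (\<lambda>g. indicator {h'} g * pmf (p h') c)"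
      by (simp add: pmf_bind eq flip: p_def)
    also have "\<dots> = pmf (history_pmf A F c\<^sub>0 t) h' * pmf (p h') c"
      by (simp add: pmf.rep_eq)
    also have "\<dots> = (if hd h = c\<^sub>0 then (\<Prod>s<t. pmf (p (take (Suc s) h')) (h' ! Suc s)) * pmf (p h') c else 0)"
      using Suc.IH[OF l] hd by simp
    also have "\<dots> = (if hd h = c\<^sub>0 then \<Prod>s<Suc t. pmf (p (take (Suc s) h)) (h ! Suc s) else 0)"
      using l by (auto simp: h nth_append)
    finally show ?case .
  qed
  have ev: "{\<omega> \<in> space \<Omega>. H \<omega> t = h} \<in> sets \<Omega> \<and>
      emeasure \<Omega> {\<omega> \<in> space \<Omega>. H \<omega> t = h} = ennreal (pmf (history_pmf A F c\<^sub>0 t) h)"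
    if l: "length h = Suc t" for t h
  proof (cases "hd h = c\<^sub>0")
    case False
    then show ?thesis using l by (simp add: H_eq pmf_H)
  next
    case True
    define J where "J = (\<lambda>s. take (Suc s) h) ` {..<t}"
    have inj: "inj_on (\<lambda>s. take (Suc s) h) {..<t}"
    proof (rule inj_onI)
      fix a b assume "a \<in> {..<t}" "b \<in> {..<t}" "take (Suc a) h = take (Suc b) h"
      then have "length (take (Suc a) h) = length (take (Suc b) h)" by simp
      then show "a = b" using l \<open>a \<in> {..<t}\<close> \<open>b \<in> {..<t}\<close> by simp
    qed
    define X where "X g = {h ! length g} \<inter> set_pmf (p g)" for g
    have "(H \<omega> t = h) \<longleftrightarrow> (\<forall>g\<in>J. \<omega> g \<in> X g)" if "\<omega> \<in> space \<Omega>" for \<omega>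
      using that l True
      by (auto simp: H_eq J_def X_def \<Omega>_def space_PiM space_K PiE_iff)
    then have eq: "{\<omega> \<in> space \<Omega>. H \<omega> t = h} = {\<omega> \<in> space \<Omega>. \<forall>g\<in>J. \<omega> g \<in> X g}" by auto
    have "finite J" and X: "X g \<in> sets (K g)" for g
      by (auto simp: J_def X_def K_single)
    have "emeasure \<Omega> {\<omega> \<in> space \<Omega>. H \<omega> t = h} = (\<Prod>g\<in>J. emeasure (K g) (X g))"
      by (subst eq, unfold \<Omega>_def, rule emeasure_PiM_Collect) (use \<open>finite J\<close> X in auto)
    also have "\<dots> = (\<Prod>g\<in>J. ennreal (pmf (p g) (h ! length g)))"
      by (simp add: X_def emeasure_K)
    also have "\<dots> = (\<Prod>s<t. ennreal (pmf (p (take (Suc s) h)) (h ! Suc s)))"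
      unfolding J_def using l by (subst prod.reindex[OF inj]) (auto intro!: prod.cong)
    also have "\<dots> = ennreal (pmf (history_pmf A F c\<^sub>0 t) h)"
      using l True by (simp add: pmf_H prod_ennreal)
    finally have "emeasure \<Omega> {\<omega> \<in> space \<Omega>. H \<omega> t = h} = ennreal (pmf (history_pmf A F c\<^sub>0 t) h)" .
    moreover have "{\<omega> \<in> space \<Omega>. \<omega> g \<in> X g} \<in> sets \<Omega>" for g
    proof -
      have "{c \<in> space (K g). c \<in> X g} = X g" by (auto simp: X_def space_K)
      then show ?thesis
        unfolding \<Omega>_def using X[of g] by (intro sets_Collect_single') simp_all
    qed
    then have "{\<omega> \<in> space \<Omega>. H \<omega> t = h} \<in> sets \<Omega>"
      by (subst eq) (intro sets.sets_Collect_finite_All \<open>finite J\<close>)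
    ultimately show ?thesis by simp
  qed
  have H_set: "H \<omega> t \<in> set_pmf (history_pmf A F c\<^sub>0 t)" if "\<omega> \<in> space \<Omega>" for \<omega> t
  proof (induction t)
    case (Suc t)
    have "\<omega> (H \<omega> t) \<in> set_pmf (p (H \<omega> t))"
      using that by (auto simp: \<Omega>_def space_PiM space_K PiE_iff)
    with Suc show ?case by (auto simp: H_Suc p_def)
  qed (simp add: H_0)
  have "(\<lambda>\<omega>. H \<omega> t) \<in> measurable \<Omega> (count_space (set_pmf (history_pmf A F c\<^sub>0 t)))" for t
  proof (subst measurable_count_space_eq_countable, safe)
    fix h assume "h \<in> set_pmf (history_pmf A F c\<^sub>0 t)"
    then show "(\<lambda>\<omega>. H \<omega> t) -` {h} \<inter> space \<Omega> \<in> sets \<Omega>"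
    proof (cases "length h = Suc t")
      case True
      with ev show ?thesis by (simp add: vimage_def Int_def conj_commute)
    next
      case False
      then have "(\<lambda>\<omega>. H \<omega> t) -` {h} = {}" using length_H by auto
      then show ?thesis by simp
    qed
  qed (use H_set in auto)
  then have "(\<lambda>\<omega>. last (H \<omega> t)) \<in> measurable \<Omega> (count_space UNIV)" for t
    by (rule measurable_compose) simp
  then have meas: "(\<lambda>\<omega> t. last (H \<omega> t)) \<in> measurable \<Omega> (\<Pi>\<^sub>M t\<in>UNIV. count_space UNIV)"
    by (intro measurable_PiM_single') auto
  define M where "M = distr \<Omega> (\<Pi>\<^sub>M t\<in>UNIV. count_space UNIV) (\<lambda>\<omega> t. last (H \<omega> t))"
  have "measure M {\<omega> \<in> space M. map \<omega> [0..<Suc t] = h} = pmf (history_pmf A F c\<^sub>0 t) h"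
    if l: "length h = Suc t" for t h
  proof -
    have "{\<omega> :: nat \<Rightarrow> positions. map \<omega> [0..<Suc t] = h} =
        {\<omega> \<in> space (\<Pi>\<^sub>M t\<in>UNIV. count_space UNIV). \<forall>s\<le>t. \<omega> s = h ! s}"
      using l by (auto simp: list_eq_iff_nth_eq space_PiM less_Suc_eq_le simp del: upt_Suc)
    also have "\<dots> \<in> sets (\<Pi>\<^sub>M t\<in>UNIV. count_space UNIV)"
      by measurable
    finally have "measure M {\<omega> \<in> space M. map \<omega> [0..<Suc t] = h} =
        measure \<Omega> {\<omega> \<in> space \<Omega>. map (\<lambda>s. last (H \<omega> s)) [0..<Suc t] = h}"
      unfolding M_def
      by (subst measure_distr[OF meas])
         (auto simp: space_PiM vimage_def Int_def conj_commute simp del: upt_Suc)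
    then show ?thesis
      using ev[OF l] by (simp only: map_H) (simp add: measure_def)
  qed
  moreover have "prob_space \<Omega>"
    unfolding \<Omega>_def by unfold_locales
  then have "prob_space M"
    unfolding M_def using meas by (rule prob_space.prob_space_distr)
  ultimately show ?thesis
    by (auto simp: execution_law_def M_def)
qed

definition scattering :: "algorithm \<Rightarrow> bool" where
  "scattering A \<longleftrightarrow>
     (\<forall>F c\<^sub>0 M. admissible F \<longrightarrow> execution_law A F c\<^sub>0 M \<longrightarrow>
        (AE \<omega> in M. \<forall>\<^sub>F t in sequentially. distinct (\<omega> t)))"

definition canonical_scattering :: "algorithm \<Rightarrow> bool" where
  "canonical_scattering A \<longleftrightarrow> canonical A \<and> scattering A"

text \<open>Number of rounds after which no two robots ever share a location (\<open>\<infinity>\<close> if there is none).\<close>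
definition scattering_time :: "(nat \<Rightarrow> positions) \<Rightarrow> ennreal" where
  "scattering_time \<omega> = (INF t\<in>{t. \<forall>s\<ge>t. distinct (\<omega> s)}. of_nat t)"

text \<open>
  \<open>g n\<close> bounds the expected time of \<open>n\<close> robots in the worst case over their initial positions
  and over the adversary.
\<close>
definition scatters_in_expected_bigo :: "algorithm \<Rightarrow> (nat \<Rightarrow> nat) \<Rightarrow> bool" where
  "scatters_in_expected_bigo A f \<longleftrightarrow>
     (\<exists>g \<in> O(\<lambda>n. real (f n)). \<forall>F c\<^sub>0 M. admissible F \<longrightarrow> execution_law A F c\<^sub>0 M \<longrightarrow>
        (\<integral>\<^sup>+ \<omega>. scattering_time \<omega> \<partial>M) \<le> ennreal (g (length c\<^sub>0)))"

text \<open>A surjective \<open>f\<close> that is not the identity cannot be strictly increasing.\<close>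
definition rate_functions :: "(nat \<Rightarrow> nat) set" where
  "rate_functions = {f. mono f \<and> surj f}"

definition max_preimage :: "(nat \<Rightarrow> nat) \<Rightarrow> nat \<Rightarrow> nat" where
  "max_preimage f y = Max {x. f x = y}"

definition load_constant :: "nat \<Rightarrow> bool" where
  "load_constant N \<longleftrightarrow>
     (\<forall>m k. N < m \<longrightarrow> 1 \<le> k \<longrightarrow> k \<le> 8 * m ^ 3 \<longrightarrow>
        measure_pmf.prob (Pi_pmf {..<m} undefined (\<lambda>_. pmf_of_set {..<k}))
          {d. \<exists>j<k. real (card {i. i < m \<and> d i = j})
                    > real m / real k * (1 + real k powr (3 / 4))}
        \<le> 1 / (2 * real k))"

text \<open>Cells are open, so that distinct points have disjoint cells.\<close>
definition voronoi_cell :: "point set \<Rightarrow> point \<Rightarrow> point set" where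
  "voronoi_cell U P = {z. \<forall>Q \<in> U - {P}. dist z P < dist z Q}"

text \<open>
  How the \<open>k\<close> positions are picked inside the cell is left open; \<open>pick U P k\<close> stands for an
  arbitrary way of doing so.
\<close>
definition cell_selection :: "(point set \<Rightarrow> point \<Rightarrow> nat \<Rightarrow> point set) \<Rightarrow> bool" where
  "cell_selection pick \<longleftrightarrow>
     (\<forall>U P k. finite U \<longrightarrow> P \<in> U \<longrightarrow>
        pick U P k \<subseteq> voronoi_cell U P \<and> finite (pick U P k) \<and> card (pick U P k) = k)"

lemma cell_selection_exists: "\<exists>pick. cell_selection pick"
proof -
  have "\<exists>S. S \<subseteq> voronoi_cell U P \<and> finite S \<and> card S = k" if "finite U" for U P k
  proof -
    have "voronoi_cell U P = (\<Inter>Q\<in>U - {P}. {z. dist z P < dist z Q})"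
      by (auto simp: voronoi_cell_def)
    moreover have "open {z. dist z P < dist z Q}" for Q
      by (intro open_Collect_less continuous_intros)
    ultimately have "open (voronoi_cell U P)"
      using that by (simp add: open_INT)
    moreover have "P \<in> voronoi_cell U P"
      by (auto simp: voronoi_cell_def)
    ultimately have "infinite (voronoi_cell U P)"
      using finite_imp_not_open by blast
    then show ?thesis
      using infinite_arbitrarily_large by blast
  qed
  then show ?thesis
    unfolding cell_selection_def by metis
qed

text \<open>The observed configuration enters through its support only: no multiplicity detection.\<close>
definition SA ::
    "nat \<Rightarrow> (point set \<Rightarrow> point \<Rightarrow> nat \<Rightarrow> point set) \<Rightarrow> (nat \<Rightarrow> nat) \<Rightarrow> algorithm" where
  "SA N pick f C P =
     (let U = set_mset C;
          u = card U;
          x = max_preimage f (f u + 1);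
          k = max (8 * N ^ 3) (max (16 * x ^ 4) (u ^ 3))
      in pick U P k)"

end

theory Submission
  imports Defs
begin

text \<open>
  Let \<open>u\<close> be the current number of occupied positions and \<open>x\<close> the largest number with
  \<open>f x = f u + 1\<close>. Any two robots collide with probability at most \<open>1 / k\<close>, whatever their
  coordinate systems are, and \<open>k \<ge> 16 * x ^ 4\<close>; hence with probability at least \<open>1 / 2\<close> the
  first \<open>min x n\<close> robots reach distinct positions. Then either all robots are scattered or at
  least \<open>x\<close> positions are occupied, so that \<open>f u\<close> has grown. As Voronoi cells are disjoint, \<open>u\<close>
  never decreases, and therefore the potential \<open>f n + 1 - f u\<close> (set to \<open>0\<close> once the robots are
  scattered) is a supermartingale with drift \<open>1 / 2\<close> until scattering, which bounds the expected
  scattering time by \<open>2 * (f n + 1)\<close>.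
\<close>

section \<open>Rate functions\<close>

lemma rate_function_unbounded:
  assumes "f \<in> rate_functions"
  obtains n where "\<And>m. n \<le> m \<Longrightarrow> y \<le> f m"
proof -
  obtain n where "f n = y"
    using assms by (auto simp: rate_functions_def surj_def) metis
  then show ?thesis
    using assms that by (auto simp: rate_functions_def mono_def)
qed

text \<open>A monotone surjection exceeds every value from some point on, so each level set is
  finite and nonempty and its \<open>Max\<close> belongs to it. An argument at most \<open>x\<close>
  has value at most \<open>f x\<close> by monotonicity, which excludes the value
  \<open>f x + 1\<close>.\<close>

lemma
  assumes "f \<in> rate_functions"
  shows rate_function_max_preimage: "f (max_preimage f y) = y"
    and max_preimage_less: "x < max_preimage f (f x + 1)"
proof -
  have *: "f (max_preimage f y) = y" for y
  proof -
    obtain n where "\<And>m. n \<le> m \<Longrightarrow> Suc y \<le> f m"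
      using rate_function_unbounded[OF assms] by blast
    then have "{x. f x = y} \<subseteq> {..<n}"
      by (metis (mono_tags) Suc_n_not_le_n lessThan_iff mem_Collect_eq not_le subsetI)
    then have "finite {x. f x = y}"
      by (rule finite_subset) simp
    moreover have "{x. f x = y} \<noteq> {}"
      using assms by (auto simp: rate_functions_def surj_def) metis
    ultimately show ?thesis
      unfolding max_preimage_def using Max_in by blast
  qed
  show "f (max_preimage f y) = y" by (rule *)
  show "x < max_preimage f (f x + 1)"
  proof (rule ccontr)
    assume "\<not> ?thesis"
    then have "f (max_preimage f (f x + 1)) \<le> f x"
      using assms by (auto simp: rate_functions_def mono_def)
    then show False by (simp add: *)
  qed
qed

section \<open>Destinations\<close>

text \<open>The \<open>k\<close> of \<open>SA\<close> as a function of the number of occupied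
  positions alone, a quantity on which all coordinate systems agree.\<close>

definition num_destinations :: "nat \<Rightarrow> (nat \<Rightarrow> nat) \<Rightarrow> nat \<Rightarrow> nat" where
  "num_destinations N f u = max (8 * N ^ 3) (max (16 * max_preimage f (f u + 1) ^ 4) (u ^ 3))"

lemma SA_cell:
  assumes "cell_selection pick" "P \<in># C"
  shows "SA N pick f C P \<subseteq> voronoi_cell (set_mset C) P"
    and "finite (SA N pick f C P)"
    and "card (SA N pick f C P) = num_destinations N f (card (set_mset C))"
proof -
  have "SA N pick f C P = pick (set_mset C) P (num_destinations N f (card (set_mset C)))"
    by (simp add: SA_def Let_def num_destinations_def)
  then show "SA N pick f C P \<subseteq> voronoi_cell (set_mset C) P"
    and "finite (SA N pick f C P)"
    and "card (SA N pick f C P) = num_destinations N f (card (set_mset C))"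
    using assms by (simp_all add: cell_selection_def)
qed

text \<open>A similarity multiplies all distances by one positive factor, so it preserves
  comparisons of distances and hence Voronoi cells. Destinations of robots with different frames can
  therefore be compared in one global diagram.\<close>

lemma destinations_SA_subset_voronoi_cell:
  assumes "cell_selection pick" "P \<in># C" "frame \<phi>"
  shows "destinations (SA N pick f) \<phi> C P \<subseteq> voronoi_cell (set_mset C) P"
proof
  fix z assume "z \<in> destinations (SA N pick f) \<phi> C P"
  then obtain w where w: "z = inv \<phi> w" "w \<in> SA N pick f (image_mset \<phi> C) (\<phi> P)"
    by (auto simp: destinations_def)
  from assms(3) obtain r where \<phi>: "bij \<phi>" "r > 0" "\<And>x y. dist (\<phi> x) (\<phi> y) = r * dist x y"
    by (auto simp: frame_def)
  have "w = \<phi> z"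
    using w(1) \<phi>(1) by (simp add: bij_is_surj surj_f_inv_f)
  moreover have "w \<in> voronoi_cell (\<phi> ` set_mset C) (\<phi> P)"
    using w(2) assms(2) SA_cell(1)[OF assms(1), of "\<phi> P" "image_mset \<phi> C"] by auto
  ultimately have cell: "\<forall>Q\<in>\<phi> ` set_mset C - {\<phi> P}. r * dist z P < dist (\<phi> z) Q"
    by (simp add: voronoi_cell_def \<phi>(3))
  show "z \<in> voronoi_cell (set_mset C) P"
    unfolding voronoi_cell_def
  proof (intro CollectI ballI)
    fix Q assume "Q \<in> set_mset C - {P}"
    then have "\<phi> Q \<in> \<phi> ` set_mset C - {\<phi> P}"
      using \<phi>(1) by (auto simp: bij_def inj_eq)
    then have "r * dist z P < r * dist z Q"
      using cell by (metis \<phi>(3))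
    then show "dist z P < dist z Q" using \<phi>(2) by simp
  qed
qed

lemma voronoi_cells_disjoint:
  assumes "P \<in> U" "Q \<in> U" "P \<noteq> Q"
  shows "voronoi_cell U P \<inter> voronoi_cell U Q = {}"
proof (rule equals0I)
  fix z assume "z \<in> voronoi_cell U P \<inter> voronoi_cell U Q"
  then have "dist z P < dist z Q" "dist z Q < dist z P"
    using assms by (auto simp: voronoi_cell_def)
  then show False by simp
qed

text \<open>A frame is a bijection: it changes neither the number of occupied positions, which
  determines \<open>k\<close>, nor the size of the set pulled back.\<close>

lemma destinations_SA_card:
  assumes "cell_selection pick" "P \<in># C" "frame \<phi>"
  shows "finite (destinations (SA N pick f) \<phi> C P)"
    and "card (destinations (SA N pick f) \<phi> C P) = num_destinations N f (card (set_mset C))"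
proof -
  have \<phi>: "bij \<phi>" using assms(3) by (simp add: frame_def)
  have card: "card (\<phi> ` set_mset C) = card (set_mset C)"
    using \<phi> by (intro card_image) (auto simp: bij_def inj_on_def)
  define S where "S = SA N pick f (image_mset \<phi> C) (\<phi> P)"
  have S: "finite S" "card S = num_destinations N f (card (set_mset C))"
    using assms(2) SA_cell(2,3)[OF assms(1), of "\<phi> P" "image_mset \<phi> C"]
    by (simp_all add: S_def card)
  have "inj (inv \<phi>)"
    using \<phi> by (simp add: bij_imp_bij_inv bij_is_inj)
  then have "card (inv \<phi> ` S) = card S"
    by (intro card_image) (auto simp: inj_on_def)
  then show "finite (destinations (SA N pick f) \<phi> C P)"
    and "card (destinations (SA N pick f) \<phi> C P) = num_destinations N f (card (set_mset C))"
    using S by (auto simp: destinations_def S_def)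
qed

lemma num_destinations_pos: "0 < u \<Longrightarrow> 0 < num_destinations N f u"
  by (simp add: num_destinations_def less_max_iff_disj)

lemma canonical_SA:
  assumes "cell_selection pick"
  shows "canonical (SA N pick f)"
  unfolding canonical_def
proof (intro conjI)
  have "0 < num_destinations N f (card (set_mset C))" if "P \<in># C" for P and C :: "point multiset"
    using that by (intro num_destinations_pos) (auto simp: card_gt_0_iff)
  then show "\<exists>k. \<forall>C P \<phi>. P \<in># C \<longrightarrow> frame \<phi> \<longrightarrow> 0 < k C P \<and>
      finite (destinations (SA N pick f) \<phi> C P) \<and> card (destinations (SA N pick f) \<phi> C P) = k C P"
    using destinations_SA_card[OF assms]
    by (intro exI[of _ "\<lambda>C P. num_destinations N f (card (set_mset C))"]) auto
  show "\<forall>C P Q \<phi> \<psi>. P \<in># C \<longrightarrow> Q \<in># C \<longrightarrow> P \<noteq> Q \<longrightarrow> frame \<phi> \<longrightarrow> frame \<psi> \<longrightarrow>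
      destinations (SA N pick f) \<phi> C P \<inter> destinations (SA N pick f) \<psi> C Q = {}"
  proof (intro allI impI)
    fix C :: "point multiset" and P Q and \<phi> \<psi> :: "point \<Rightarrow> point"
    assume "P \<in># C" "Q \<in># C" "P \<noteq> Q" "frame \<phi>" "frame \<psi>"
    then show "destinations (SA N pick f) \<phi> C P \<inter> destinations (SA N pick f) \<psi> C Q = {}"
      using Int_mono[OF destinations_SA_subset_voronoi_cell[OF assms, of P C \<phi> N f]
          destinations_SA_subset_voronoi_cell[OF assms, of Q C \<psi> N f]]
        voronoi_cells_disjoint[of P "set_mset C" Q] by simp
  qed
qed

section \<open>One round\<close>

lemma set_round_pmf:
  assumes "canonical A" "\<And>i. frame (\<Phi> i)" "c' \<in> set_pmf (round_pmf A \<Phi> c)"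
  shows "length c' = length c"
    and "\<And>i. i < length c \<Longrightarrow> c' ! i \<in> destinations A (\<Phi> i) (mset c) (c ! i)"
proof -
  obtain d where d: "d \<in> set_pmf (Pi_pmf {..<length c} undefined
      (\<lambda>i. pmf_of_set (destinations A (\<Phi> i) (mset c) (c ! i))))" "c' = map d [0..<length c]"
    using assms(3) by (auto simp: round_pmf_def)
  then show "length c' = length c" by simp
  fix i assume i: "i < length c"
  have "finite (destinations A (\<Phi> i) (mset c) (c ! i)) \<and> destinations A (\<Phi> i) (mset c) (c ! i) \<noteq> {}"
    using assms(1,2) i unfolding canonical_def by (metis card.empty less_irrefl nth_mem_mset)
  then have "set_pmf (pmf_of_set (destinations A (\<Phi> i) (mset c) (c ! i))) =
      destinations A (\<Phi> i) (mset c) (c ! i)"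
    by simp
  moreover have "d i \<in> set_pmf (pmf_of_set (destinations A (\<Phi> i) (mset c) (c ! i)))"
    using d(1) i by (auto simp: set_Pi_pmf PiE_dflt_def)
  ultimately show "c' ! i \<in> destinations A (\<Phi> i) (mset c) (c ! i)"
    using d(2) i by simp
qed

text \<open>The two destination sets are disjoint even if the frames differ. Separation is thus
  certain for every possible outcome, which makes scattered configurations absorbing.\<close>

lemma round_separates:
  assumes "canonical A" "\<And>i. frame (\<Phi> i)" "c' \<in> set_pmf (round_pmf A \<Phi> c)"
    and "i < length c" "j < length c" "c ! i \<noteq> c ! j"
  shows "c' ! i \<noteq> c' ! j"
proof -
  have "destinations A (\<Phi> i) (mset c) (c ! i) \<inter> destinations A (\<Phi> j) (mset c) (c ! j) = {}"
    using assms unfolding canonical_def by (metis nth_mem_mset)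
  then show ?thesis
    using set_round_pmf(2)[OF assms(1-3)] assms(4,5) by (metis disjoint_iff)
qed

lemma round_distinct:
  assumes "canonical A" "\<And>i. frame (\<Phi> i)" "c' \<in> set_pmf (round_pmf A \<Phi> c)" "distinct c"
  shows "distinct c'"
  using round_separates[OF assms(1-3)] set_round_pmf(1)[OF assms(1-3)] assms(4)
  by (simp add: distinct_conv_nth)

text \<open>Choose one robot at each occupied position; these representatives are pairwise apart and
  remain so after the round.\<close>

lemma round_card_mono:
  assumes "canonical A" "\<And>i. frame (\<Phi> i)" "c' \<in> set_pmf (round_pmf A \<Phi> c)"
  shows "card (set c) \<le> card (set c')"
proof -
  define g where "g P = (SOME i. i < length c \<and> c ! i = P)" for P
  have g: "g P < length c \<and> c ! g P = P" if "P \<in> set c" for P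
    unfolding g_def by (rule someI_ex) (use that in \<open>auto simp: in_set_conv_nth\<close>)
  have "inj_on (\<lambda>P. c' ! g P) (set c)"
    using round_separates[OF assms] g by (intro inj_onI) metis
  moreover have "(\<lambda>P. c' ! g P) ` set c \<subseteq> set c'"
    using g set_round_pmf(1)[OF assms] by auto
  ultimately show ?thesis
    by (intro card_inj_on_le[of _ "set c"]) auto
qed

section \<open>Collision probabilities in one round\<close>

text \<open>Condition on all coordinates except \<open>i\<close>: the value at \<open>j\<close> is
  then fixed, and a uniform draw from \<open>S i\<close> hits it with probability
  \<open>1 / card (S i)\<close> or 0. The sets \<open>S i\<close> and \<open>S j\<close> may differ,
  as they do for robots with different frames.\<close>

lemma prob_Pi_pmf_of_set_eq_le:
  fixes S :: "'i \<Rightarrow> 'a set"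
  assumes "finite I" "i \<in> I" "i \<noteq> j" "finite (S i)" "S i \<noteq> {}"
  shows "measure_pmf.prob (Pi_pmf I dflt (\<lambda>i. pmf_of_set (S i))) {d. d i = d j} \<le> 1 / card (S i)"
proof -
  define p where "p = (\<lambda>i. pmf_of_set (S i))"
  have "Pi_pmf I dflt p = Pi_pmf (insert i (I - {i})) dflt p"
    using assms(2) by (simp add: insert_absorb)
  also have "\<dots> = map_pmf (\<lambda>(y, g). g(i := y)) (pair_pmf (p i) (Pi_pmf (I - {i}) dflt p))"
    using assms(1) by (intro Pi_pmf_insert) auto
  \<comment> \<open>The independent draws are reordered so that coordinate \<open>i\<close> comes
    last.\<close>
  also have "\<dots> = bind_pmf (Pi_pmf (I - {i}) dflt p) (\<lambda>g. map_pmf (\<lambda>y. g(i := y)) (p i))"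
    unfolding pair_pmf_def
    by (subst bind_commute_pmf) (simp add: map_bind_pmf map_pmf_def bind_assoc_pmf bind_return_pmf)
  finally have eq: "Pi_pmf I dflt p = \<dots>" .
  have "emeasure (Pi_pmf I dflt p) {d. d i = d j} =
      (\<integral>\<^sup>+g. emeasure (map_pmf (\<lambda>y. g(i := y)) (p i)) {d. d i = d j} \<partial>Pi_pmf (I - {i}) dflt p)"
    by (subst eq, rule emeasure_bind_pmf)
  also have "\<dots> = (\<integral>\<^sup>+g. ennreal (pmf (p i) (g j)) \<partial>Pi_pmf (I - {i}) dflt p)"
  proof (rule nn_integral_cong)
    fix g :: "'i \<Rightarrow> 'a"
    \<comment> \<open>As \<open>i \<noteq> j\<close>, the update leaves the value at
      \<open>j\<close> alone, so the event forces \<open>y = g j\<close>.\<close>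
    have "(\<lambda>y. g(i := y)) -` {d. d i = d j} = {g j}"
      using assms(3) by auto
    then show "emeasure (map_pmf (\<lambda>y. g(i := y)) (p i)) {d. d i = d j} = ennreal (pmf (p i) (g j))"
      by (simp only: emeasure_map_pmf emeasure_pmf_single)
  qed
  also have "\<dots> \<le> (\<integral>\<^sup>+g. ennreal (1 / real (card (S i))) \<partial>Pi_pmf (I - {i}) dflt p)"
    using assms(4,5) by (intro nn_integral_mono ennreal_leI) (simp add: p_def indicator_def)
  also have "\<dots> = ennreal (1 / real (card (S i)))" by simp
  finally show ?thesis
    by (simp add: p_def measure_pmf.emeasure_eq_measure)
qed

text \<open>Union bound over the ordered pairs among the first \<open>m\<close> robots: at most
  \<open>m\<^sup>2\<close> pairs collide with probability at most \<open>1 / k\<close> each, and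
  \<open>2 * m\<^sup>2 \<le> k\<close>.\<close>

lemma prob_round_distinct_take:
  assumes "canonical A" "\<And>i. frame (\<Phi> i)" "m \<le> length c" "2 * m\<^sup>2 \<le> k"
    and k: "\<And>i. i < length c \<Longrightarrow> k \<le> card (destinations A (\<Phi> i) (mset c) (c ! i))"
  shows "1 / 2 \<le> measure_pmf.prob (round_pmf A \<Phi> c) {c'. distinct (take m c')}"
proof (cases "m = 0")
  case True
  then show ?thesis by simp
next
  case False
  define D where "D i = destinations A (\<Phi> i) (mset c) (c ! i)" for i
  define q where "q = Pi_pmf {..<length c} undefined (\<lambda>i. pmf_of_set (D i))"
  define R where "R = {..<m} \<times> {..<m} - Id"
  \<comment> \<open>This is why \<open>m = 0\<close> was split off: only for positive
    \<open>m\<close> does the bound on \<open>k\<close> exclude \<open>k = 0\<close>.\<close>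
  have "0 < k" using assms(4) False by (auto intro: Nat.gr0I)
  have D: "finite (D i)" "D i \<noteq> {}" "k \<le> card (D i)" if "i < m" for i
    using k[of i] that \<open>m \<le> length c\<close> \<open>0 < k\<close> by (auto simp: D_def intro: card_ge_0_finite)
  have eq: "distinct (take m (map d [0..<length c])) \<longleftrightarrow> d \<notin> (\<Union>(i, j)\<in>R. {d. d i = d j})" for d :: "nat \<Rightarrow> point"
    using \<open>m \<le> length c\<close> by (auto simp: R_def distinct_conv_nth)
  have "measure_pmf.prob q (\<Union>(i, j)\<in>R. {d. d i = d j}) \<le>
      (\<Sum>x\<in>R. measure_pmf.prob q (case x of (i, j) \<Rightarrow> {d. d i = d j}))"
    by (rule measure_pmf.finite_measure_subadditive_finite) (auto simp: R_def)
  also have "\<dots> \<le> (\<Sum>x\<in>R. 1 / k)"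
  proof (rule sum_mono, clarify)
    fix i j assume "(i, j) \<in> R"
    then have "i < m" "i \<noteq> j" by (auto simp: R_def)
    then have "measure_pmf.prob q {d. d i = d j} \<le> 1 / card (D i)"
      unfolding q_def using D \<open>m \<le> length c\<close> by (intro prob_Pi_pmf_of_set_eq_le) auto
    also have "\<dots> \<le> 1 / k"
      using D(3)[OF \<open>i < m\<close>] \<open>0 < k\<close> by (intro divide_left_mono) auto
    finally show "measure_pmf.prob q {d. d i = d j} \<le> 1 / k" .
  qed
  also have "\<dots> \<le> 1 / 2"
  proof -
    have "card R \<le> m\<^sup>2"
      using card_mono[of "{..<m} \<times> {..<m}" R] by (simp add: R_def power2_eq_square)
    then have "2 * card R \<le> k" using assms(4) by linarith
    then have "2 * real (card R) \<le> real k" by linarith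
    then show ?thesis using \<open>0 < k\<close> by (simp add: field_simps)
  qed
  finally have "measure_pmf.prob q (\<Union>(i, j)\<in>R. {d. d i = d j}) \<le> 1 / 2" .
  moreover have "{d :: nat \<Rightarrow> point. distinct (take m (map d [0..<length c]))} = UNIV - (\<Union>(i, j)\<in>R. {d. d i = d j})"
    using eq by auto
  then have "(\<lambda>d :: nat \<Rightarrow> point. map d [0..<length c]) -` {c'. distinct (take m c')} =
      UNIV - (\<Union>(i, j)\<in>R. {d. d i = d j})"
    by (simp only: vimage_Collect_eq)
  then have "measure_pmf.prob (round_pmf A \<Phi> c) {c'. distinct (take m c')} =
      measure_pmf.prob q (UNIV - (\<Union>(i, j)\<in>R. {d. d i = d j}))"
    by (simp only: round_pmf_def q_def D_def measure_map_pmf)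
  moreover have "\<dots> = 1 - measure_pmf.prob q (\<Union>(i, j)\<in>R. {d. d i = d j})"
    using measure_pmf.prob_compl[of "\<Union>(i, j)\<in>R. {d. d i = d j}" q] by simp
  ultimately show ?thesis by simp
qed

section \<open>The potential and its drift\<close>

text \<open>The \<open>+ 1\<close> keeps the potential positive, for monotone \<open>f\<close>,
  while robots still share a location, even if \<open>f (card (set c))\<close> has reached
  \<open>f (length c)\<close>. Scattering then always lowers it by at least one.\<close>

definition potential :: "(nat \<Rightarrow> nat) \<Rightarrow> positions \<Rightarrow> nat" where
  "potential f c = (if distinct c then 0 else f (length c) + 1 - f (card (set c)))"

text \<open>The potential never rises, and from an unscattered configuration it drops by at least
  one with probability at least \<open>1 / 2\<close>. Doubling and adding the drift on the left
  avoids division and subtraction in \<open>ennreal\<close>.\<close>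

lemma potential_drift:
  assumes f: "f \<in> rate_functions" and pick: "cell_selection pick" and \<Phi>: "\<And>i. frame (\<Phi> i)"
  shows "2 * (\<integral>\<^sup>+c'. of_nat (potential f c') \<partial>round_pmf (SA N pick f) \<Phi> c) + indicator {c. \<not> distinct c} c
      \<le> 2 * (of_nat (potential f c) :: ennreal)"
proof (cases "distinct c")
  case True
  then have "potential f c' = 0" if "c' \<in> set_pmf (round_pmf (SA N pick f) \<Phi> c)" for c'
    using round_distinct[OF canonical_SA[OF pick] \<Phi> that] by (simp add: potential_def)
  then have "(\<integral>\<^sup>+c'. of_nat (potential f c') \<partial>round_pmf (SA N pick f) \<Phi> c) = 0"
    by (subst nn_integral_0_iff_AE) (auto simp: AE_measure_pmf_iff)
  then show ?thesis using True by simp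
next
  case False
  define A where "A = SA N pick f"
  define p where "p = round_pmf A \<Phi> c"
  define n where "n = length c"
  define u where "u = card (set c)"
  define x where "x = max_preimage f (f u + 1)"
  have canon: "canonical A" unfolding A_def using pick by (rule canonical_SA)
  have mono: "\<And>a b. a \<le> b \<Longrightarrow> f a \<le> f b" using f by (auto simp: rate_functions_def mono_def)
  have "u < n"
    using False card_distinct[of c] card_length[of c] by (auto simp: u_def n_def le_less)
  have x: "f x = f u + 1" "u < x"
    using rate_function_max_preimage[OF f] max_preimage_less[OF f] by (simp_all add: x_def)
  define G :: "positions set" where "G = {c'. distinct (take (min x n) c')}"
  have "1 / 2 \<le> measure_pmf.prob p G"
    unfolding p_def G_def
  proof (rule prob_round_distinct_take[OF canon \<Phi>])
    show "min x n \<le> length c" by (simp add: n_def)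
    show "2 * (min x n)\<^sup>2 \<le> num_destinations N f u"
    proof -
      have "(min x n)\<^sup>2 \<le> x\<^sup>2" by (intro power_mono) auto
      \<comment> \<open>\<open>u < x\<close> gives \<open>1 \<le> x\<close>, which this comparison
        of powers relies on.\<close>
      moreover have "x\<^sup>2 \<le> x ^ 4" using x(2) by (intro power_increasing) auto
      moreover have "16 * x ^ 4 \<le> num_destinations N f u"
        by (simp add: num_destinations_def x_def)
      ultimately show ?thesis by linarith
    qed
    show "num_destinations N f u \<le> card (destinations A (\<Phi> i) (mset c) (c ! i))" if "i < length c" for i
      using that destinations_SA_card(2)[OF pick _ \<Phi>] by (simp add: A_def u_def)
  qed
  then have "ennreal 1 \<le> ennreal (2 * measure_pmf.prob p G)"
    by (intro ennreal_leI) simp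
  then have half: "1 \<le> 2 * emeasure p G"
    by (simp add: measure_pmf.emeasure_eq_measure ennreal_mult)
  \<comment> \<open>The drift holds outcome by outcome, so integrating it leaves only the
    probability of \<open>G\<close> to be estimated.\<close>
  have step: "potential f c' + (if c' \<in> G then 1 else 0) \<le> potential f c" if "c' \<in> set_pmf p" for c'
  proof -
    have len: "length c' = n" and card: "u \<le> card (set c')"
      using set_round_pmf(1)[OF canon \<Phi>] round_card_mono[OF canon \<Phi>] that
      by (auto simp: p_def n_def u_def)
    have pot: "potential f c = Suc (f n - f u)" "f u \<le> f n"
      using False \<open>u < n\<close> mono by (auto simp: potential_def n_def u_def Suc_diff_le)
    show ?thesis
    proof (cases "distinct c'")
      case True
      then have "potential f c' = 0" by (simp add: potential_def)
      then show ?thesis using pot by simp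
    next
      case nd: False
      have "f u \<le> f (card (set c'))" "f (card (set c')) \<le> f n"
        using card mono card_length[of c'] len by auto
      moreover have "f u + 1 \<le> f (card (set c'))" if "c' \<in> G"
      proof -
        have dist: "distinct (take (min x n) c')" using that by (simp add: G_def)
        \<comment> \<open>If \<open>n \<le> x\<close>, the prefix of length \<open>min x n\<close>
          would be all of \<open>c'\<close>, making \<open>c'\<close> distinct.\<close>
        with nd len have "x < n" by (cases "x < n") auto
        have "x = card (set (take x c'))"
          using distinct_card[OF dist] \<open>x < n\<close> len by simp
        also have "\<dots> \<le> card (set c')" by (intro card_mono) (auto dest: in_set_takeD)
        finally show ?thesis using mono x(1) by metis
      qed
      ultimately show ?thesis
        using nd pot by (auto simp: potential_def len)
    qed
  qed
  have "2 * (\<integral>\<^sup>+c'. of_nat (potential f c') \<partial>p) + 1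
      \<le> 2 * (\<integral>\<^sup>+c'. of_nat (potential f c') \<partial>p) + 2 * emeasure p G"
    using half by (rule add_left_mono)
  also have "\<dots> = 2 * (\<integral>\<^sup>+c'. of_nat (potential f c') + indicator G c' \<partial>p)"
    by (simp add: nn_integral_add distrib_left)
  also have "\<dots> \<le> 2 * (\<integral>\<^sup>+c'. of_nat (potential f c) \<partial>p)"
  proof (intro mult_left_mono nn_integral_mono_AE)
    show "AE c' in p. of_nat (potential f c') + indicator G c' \<le> (of_nat (potential f c) :: ennreal)"
      unfolding AE_measure_pmf_iff
    proof
      fix c' assume "c' \<in> set_pmf p"
      then have "(of_nat (potential f c' + (if c' \<in> G then 1 else 0)) :: ennreal) \<le> of_nat (potential f c)"
        using step by (simp only: of_nat_le_iff)
      then show "of_nat (potential f c') + indicator G c' \<le> (of_nat (potential f c) :: ennreal)"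
        by (simp add: indicator_def split: if_splits)
    qed
  qed simp
  also have "\<dots> = 2 * of_nat (potential f c)" by simp
  finally show ?thesis using False by (simp add: p_def A_def)
qed

section \<open>Histories and executions\<close>

text \<open>A history at time \<open>t\<close> has \<open>t + 1\<close> entries, and the adversary
  fixes the frames of the round leaving time \<open>s\<close> from \<open>take (Suc s) h\<close>,
  which ends with \<open>h ! s\<close>. Facts valid for every outcome of a round thereby pass to
  histories.\<close>

lemma set_history_pmf:
  assumes "h \<in> set_pmf (history_pmf A F c\<^sub>0 t)"
  shows "length h = Suc t" and "h \<noteq> []"
    and "\<And>s. s < t \<Longrightarrow> h ! Suc s \<in> set_pmf (round_pmf A (F (take (Suc s) h)) (h ! s))"
  using assms
proof (induction t arbitrary: h)
  case (Suc t)
  {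
    case 1
    then show ?case using Suc.IH(1) by auto
  next
    case 2
    then show ?case by auto
  next
    case (3 s)
    then obtain g c where g: "h = g @ [c]" "g \<in> set_pmf (history_pmf A F c\<^sub>0 t)"
      "c \<in> set_pmf (round_pmf A (F g) (last g))" by auto
    have len: "length g = Suc t" "g \<noteq> []" using Suc.IH(1,2) g(2) by auto
    show ?case
    proof (cases "s = t")
      case True
      then show ?thesis using g len by (simp add: nth_append last_conv_nth)
    next
      case False
      then show ?thesis using Suc.IH(3)[OF _ g(2), of s] 3 len g(1) by (simp add: nth_append)
    qed
  }
qed auto

text \<open>Given a history the frames are fixed, so the drift applies to each history separately;
  integrating over histories and telescoping over time charges all unscattered rounds to the initial
  potential.\<close>

lemma sum_prob_not_distinct_le:
  assumes f: "f \<in> rate_functions" and pick: "cell_selection pick" and F: "admissible F"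
  shows "(\<Sum>s<t. emeasure (history_pmf (SA N pick f) F c\<^sub>0 s) {h. \<not> distinct (last h)})
      \<le> 2 * of_nat (potential f c\<^sub>0)"
proof -
  define H where "H = history_pmf (SA N pick f) F c\<^sub>0"
  define E where "E t = (\<integral>\<^sup>+h. of_nat (potential f (last h)) \<partial>H t)" for t
  define B where "B t = emeasure (H t) {h. \<not> distinct (last h)}" for t
  have step: "2 * E (Suc t) + B t \<le> 2 * E t" for t
  proof -
    define V where "V h = (\<integral>\<^sup>+c'. of_nat (potential f c') \<partial>round_pmf (SA N pick f) (F h) (last h))" for h
    have "E (Suc t) = (\<integral>\<^sup>+h. V h \<partial>H t)"
      by (simp add: E_def H_def V_def)
    moreover have "B t = (\<integral>\<^sup>+h. indicator {c. \<not> distinct c} (last h) \<partial>H t)"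
    proof -
      have "B t = (\<integral>\<^sup>+h. indicator {h. \<not> distinct (last h)} h \<partial>H t)"
        unfolding B_def by (rule nn_integral_indicator[symmetric]) simp
      also have "\<dots> = (\<integral>\<^sup>+h. indicator {c. \<not> distinct c} (last h) \<partial>H t)"
        by (intro nn_integral_cong) (simp add: indicator_def)
      finally show ?thesis .
    qed
    ultimately have "2 * E (Suc t) + B t = (\<integral>\<^sup>+h. 2 * V h + indicator {c. \<not> distinct c} (last h) \<partial>H t)"
      by (simp add: nn_integral_add nn_integral_cmult)
    also have "\<dots> \<le> (\<integral>\<^sup>+h. 2 * of_nat (potential f (last h)) \<partial>H t)"
      unfolding V_def using F by (intro nn_integral_mono potential_drift f pick) (simp add: admissible_def)
    also have "\<dots> = 2 * E t" by (simp add: E_def nn_integral_cmult)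
    finally show ?thesis .
  qed
  \<comment> \<open>The remaining potential \<open>2 * E t\<close> is carried along as the induction
    invariant and discarded only at the end.\<close>
  have "(\<Sum>s<t. B s) + 2 * E t \<le> 2 * E 0"
  proof (induction t)
    case (Suc t)
    have "(\<Sum>s<Suc t. B s) + 2 * E (Suc t) = (\<Sum>s<t. B s) + (2 * E (Suc t) + B t)"
      by (simp add: algebra_simps)
    also have "\<dots> \<le> (\<Sum>s<t. B s) + 2 * E t" by (intro add_left_mono step)
    finally show ?case using Suc.IH by (rule order_trans)
  qed simp
  moreover have "E 0 = of_nat (potential f c\<^sub>0)" by (simp add: E_def H_def)
  ultimately show ?thesis
    unfolding B_def H_def using order_trans[OF le_iff_add[THEN iffD2]] by fastforce
qed

section \<open>From finite histories to the law on trajectories\<close>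

text \<open>An execution law prescribes only the probabilities of single histories. Inside the
  countable support of \<open>history_pmf\<close>, a set of histories is a countable disjoint union
  of singletons, so countable additivity applies.\<close>

lemma execution_law_finite_history:
  assumes "execution_law A F c\<^sub>0 M" "S \<subseteq> set_pmf (history_pmf A F c\<^sub>0 t)"
  shows "{\<omega> \<in> space M. map \<omega> [0..<Suc t] \<in> S} \<in> sets M"
    and "emeasure M {\<omega> \<in> space M. map \<omega> [0..<Suc t] \<in> S} = emeasure (history_pmf A F c\<^sub>0 t) S"
proof -
  interpret prob_space M using assms(1) by (simp add: execution_law_def)
  have sets_M: "sets M = sets (\<Pi>\<^sub>M t\<in>UNIV. count_space UNIV)"
    using assms(1) by (simp add: execution_law_def)
  define X where "X h = {\<omega> \<in> space M. map \<omega> [0..<Suc t] = h}" for h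
  have len: "length h = Suc t" if "h \<in> S" for h
    using that assms(2) set_history_pmf(1) by blast
  have X_sets: "X h \<in> sets M" if "h \<in> S" for h
  proof -
    have "X h = {\<omega> \<in> space (\<Pi>\<^sub>M t\<in>UNIV. count_space UNIV). \<forall>s\<le>t. \<omega> s = h ! s}"
      using len[OF that] sets_eq_imp_space_eq[OF sets_M]
      by (auto simp: X_def list_eq_iff_nth_eq less_Suc_eq_le simp del: upt_Suc)
    also have "\<dots> \<in> sets (\<Pi>\<^sub>M t\<in>UNIV. count_space UNIV)" by measurable
    finally show ?thesis by (simp add: sets_M)
  qed
  have X: "emeasure M (X h) = ennreal (pmf (history_pmf A F c\<^sub>0 t) h)" if "h \<in> S" for h
    using assms(1) len[OF that] by (simp add: execution_law_def X_def emeasure_eq_measure del: upt_Suc)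
  have count: "countable S"
    using assms(2) countable_set_pmf by (rule countable_subset)
  have eq: "{\<omega> \<in> space M. map \<omega> [0..<Suc t] \<in> S} = (\<Union>h\<in>S. X h)"
    by (auto simp: X_def simp del: upt_Suc)
  show "{\<omega> \<in> space M. map \<omega> [0..<Suc t] \<in> S} \<in> sets M"
    unfolding eq using count X_sets by (intro sets.countable_UN') auto
  have "emeasure M (\<Union>h\<in>S. X h) = (\<integral>\<^sup>+h. emeasure M (X h) \<partial>count_space S)"
    using X_sets count by (intro emeasure_UN_countable) (auto simp: disjoint_family_on_def X_def)
  also have "\<dots> = (\<integral>\<^sup>+h. ennreal (pmf (history_pmf A F c\<^sub>0 t) h) \<partial>count_space S)"
    by (intro nn_integral_cong) (simp add: X)
  also have "\<dots> = emeasure (history_pmf A F c\<^sub>0 t) S"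
    by (rule nn_integral_pmf)
  finally show "emeasure M {\<omega> \<in> space M. map \<omega> [0..<Suc t] \<in> S} = emeasure (history_pmf A F c\<^sub>0 t) S"
    by (simp only: eq)
qed

lemma AE_execution_history:
  assumes "execution_law A F c\<^sub>0 M"
  shows "AE \<omega> in M. \<forall>t. map \<omega> [0..<Suc t] \<in> set_pmf (history_pmf A F c\<^sub>0 t)"
  unfolding AE_all_countable
proof
  fix t
  interpret prob_space M using assms by (simp add: execution_law_def)
  define Y where "Y = {\<omega> \<in> space M. map \<omega> [0..<Suc t] \<in> set_pmf (history_pmf A F c\<^sub>0 t)}"
  have "emeasure M Y = 1"
    unfolding Y_def using execution_law_finite_history(2)[OF assms order_refl]
    by (simp add: emeasure_pmf del: upt_Suc)
  moreover have "Y \<in> events"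
    unfolding Y_def by (rule execution_law_finite_history(1)[OF assms order_refl])
  ultimately have "AE \<omega> in M. \<omega> \<in> Y"
    by (simp add: AE_in_set_eq_1 emeasure_eq_measure)
  then show "AE \<omega> in M. map \<omega> [0..<Suc t] \<in> set_pmf (history_pmf A F c\<^sub>0 t)"
    by (rule AE_mp) (auto simp: Y_def simp del: upt_Suc)
qed

text \<open>For arbitrary \<open>B\<close>, measurability comes from the coordinate projection. The
  probability comes from cutting the event down to the support of the histories, which loses only a
  null set.\<close>

lemma execution_law_marginal:
  assumes M: "execution_law A F c\<^sub>0 M"
  shows "{\<omega> \<in> space M. \<omega> t \<in> B} \<in> sets M"
    and "emeasure M {\<omega> \<in> space M. \<omega> t \<in> B} = emeasure (history_pmf A F c\<^sub>0 t) {h. last h \<in> B}"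
proof -
  have sets_M: "sets M = sets (\<Pi>\<^sub>M t\<in>UNIV. count_space UNIV)"
    using M by (simp add: execution_law_def)
  have "(\<lambda>\<omega>. \<omega> t) -` B \<inter> space (\<Pi>\<^sub>M t\<in>UNIV. count_space UNIV) \<in> sets (\<Pi>\<^sub>M t\<in>UNIV. count_space UNIV)"
    by (rule measurable_sets[OF measurable_component_singleton]) auto
  also have "(\<lambda>\<omega>. \<omega> t) -` B \<inter> space (\<Pi>\<^sub>M t\<in>UNIV. count_space UNIV) =
      {\<omega> \<in> space (\<Pi>\<^sub>M t\<in>UNIV. count_space UNIV). \<omega> t \<in> B}"
    by auto
  finally show meas: "{\<omega> \<in> space M. \<omega> t \<in> B} \<in> sets M"
    by (simp add: sets_M sets_eq_imp_space_eq[OF sets_M])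
  define S where "S = {h. last h \<in> B} \<inter> set_pmf (history_pmf A F c\<^sub>0 t)"
  have S: "S \<subseteq> set_pmf (history_pmf A F c\<^sub>0 t)" by (simp add: S_def)
  have "emeasure M {\<omega> \<in> space M. \<omega> t \<in> B} = emeasure M {\<omega> \<in> space M. map \<omega> [0..<Suc t] \<in> S}"
    using AE_execution_history[OF M] meas execution_law_finite_history(1)[OF M S]
    by (intro emeasure_eq_AE) (auto simp: S_def)
  also have "\<dots> = emeasure (history_pmf A F c\<^sub>0 t) {h. last h \<in> B}"
    using execution_law_finite_history(2)[OF M S] by (simp add: S_def emeasure_Int_set_pmf del: upt_Suc)
  finally show "emeasure M {\<omega> \<in> space M. \<omega> t \<in> B} = \<dots>" .
qed

text \<open>Almost surely all finite prefixes are possible histories, so each round along the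
  trajectory is a possible round and preserves distinctness.\<close>

lemma AE_execution_distinct_absorbing:
  assumes "canonical A" "admissible F" "execution_law A F c\<^sub>0 M"
  shows "AE \<omega> in M. \<forall>t s. distinct (\<omega> t) \<longrightarrow> t \<le> s \<longrightarrow> distinct (\<omega> s)"
  using AE_execution_history[OF assms(3)]
proof (rule AE_mp, intro AE_I2 impI allI)
  fix \<omega> t s
  assume h: "\<forall>t. map \<omega> [0..<Suc t] \<in> set_pmf (history_pmf A F c\<^sub>0 t)" and "distinct (\<omega> t)" "t \<le> s"
  from this(3,2) show "distinct (\<omega> s)"
  proof (induction s rule: dec_induct)
    case (step s)
    have "map \<omega> [0..<Suc (Suc s)] \<in> set_pmf (history_pmf A F c\<^sub>0 (Suc s))" using h by blast
    from set_history_pmf(3)[OF this, of s]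
    have "\<omega> (Suc s) \<in> set_pmf (round_pmf A (F (take (Suc s) (map \<omega> [0..<Suc (Suc s)]))) (\<omega> s))"
      by (simp add: nth_append del: upt_Suc)
    from round_distinct[OF assms(1) _ this] show ?case
      using assms(2) step by (simp add: admissible_def)
  qed
qed

section \<open>Scattering time and the number of unscattered rounds\<close>

text \<open>Both sides are infinite if the robots never scatter.\<close>
lemma scattering_time_le_suminf:
  assumes "\<And>t s. distinct (\<omega> t) \<Longrightarrow> t \<le> s \<Longrightarrow> distinct (\<omega> s)"
  shows "scattering_time \<omega> \<le> (\<Sum>t. indicator {t. \<not> distinct (\<omega> t)} t)"
proof (cases "\<exists>t. distinct (\<omega> t)")
  case True
  define T where "T = (LEAST t. distinct (\<omega> t))"
  have T: "distinct (\<omega> T)" and less: "\<And>t. t < T \<Longrightarrow> \<not> distinct (\<omega> t)"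
    using True by (auto simp: T_def intro: LeastI_ex dest: not_less_Least)
  have "scattering_time \<omega> \<le> of_nat T"
    unfolding scattering_time_def using assms[OF T] by (intro INF_lower) auto
  also have "\<dots> = (\<Sum>t<T. indicator {t. \<not> distinct (\<omega> t)} t)"
    using less by simp
  also have "\<dots> \<le> (\<Sum>t. indicator {t. \<not> distinct (\<omega> t)} t)"
    by (intro sum_le_suminf) auto
  finally show ?thesis .
next
  case False
  have "of_nat n \<le> (\<Sum>t. indicator {t. \<not> distinct (\<omega> t)} t :: ennreal)" for n
    using sum_le_suminf[of "\<lambda>t. indicator {t. \<not> distinct (\<omega> t)} t :: ennreal" "{..<n}"] False by simp
  then have "(\<Sum>t. indicator {t. \<not> distinct (\<omega> t)} t :: ennreal) = \<top>"
    using ennreal_Ex_less_of_nat by (metis leD top.not_eq_extremum)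
  then show ?thesis by simp
qed

text \<open>\<open>X\<close> counts the unscattered rounds and stands in for the scattering time. As
  a sum of indicators of measurable events it is measurable, and its expectation is the sum of the
  probabilities already bounded by telescoping.\<close>

lemma expected_rounds_not_distinct_le:
  assumes f: "f \<in> rate_functions" and pick: "cell_selection pick" and F: "admissible F"
    and M: "execution_law (SA N pick f) F c\<^sub>0 M"
  defines "X \<equiv> \<lambda>\<omega>. (\<Sum>t. indicator {t. \<not> distinct (\<omega> t)} t) :: ennreal"
  shows "X \<in> borel_measurable M" and "(\<integral>\<^sup>+\<omega>. X \<omega> \<partial>M) \<le> 2 * of_nat (potential f c\<^sub>0)"
proof -
  define Bad where "Bad t = {\<omega> \<in> space M. \<omega> t \<in> {c. \<not> distinct c}}" for t
  have Bad: "Bad t \<in> sets M"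
    "emeasure M (Bad t) = emeasure (history_pmf (SA N pick f) F c\<^sub>0 t) {h. \<not> distinct (last h)}" for t
    unfolding Bad_def using execution_law_marginal[OF M, of t "{c. \<not> distinct c}"] by simp_all
  have X: "X \<omega> = (\<Sum>t. indicator (Bad t) \<omega>)" if "\<omega> \<in> space M" for \<omega>
    using that by (simp add: X_def Bad_def indicator_def)
  have "(\<lambda>\<omega>. \<Sum>t. indicator (Bad t) \<omega> :: ennreal) \<in> borel_measurable M"
    using Bad(1) by (intro borel_measurable_suminf_order) auto
  then show "X \<in> borel_measurable M"
    by (subst measurable_cong[OF X])
  have "(\<integral>\<^sup>+\<omega>. X \<omega> \<partial>M) = (\<integral>\<^sup>+\<omega>. (\<Sum>t. indicator (Bad t) \<omega>) \<partial>M)"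
    by (intro nn_integral_cong X)
  also have "\<dots> = (\<Sum>t. emeasure M (Bad t))"
    using Bad(1) by (subst nn_integral_suminf) auto
  also have "\<dots> \<le> 2 * of_nat (potential f c\<^sub>0)"
    unfolding Bad(2) using sum_prob_not_distinct_le[OF f pick F]
    by (intro suminf_le_const) auto
  finally show "(\<integral>\<^sup>+\<omega>. X \<omega> \<partial>M) \<le> 2 * of_nat (potential f c\<^sub>0)" .
qed

lemma AE_scattering_time_le:
  assumes "canonical A" "admissible F" "execution_law A F c\<^sub>0 M"
  shows "AE \<omega> in M. scattering_time \<omega> \<le> (\<Sum>t. indicator {t. \<not> distinct (\<omega> t)} t)"
  using AE_execution_distinct_absorbing[OF assms]
  by (rule AE_mp) (intro AE_I2 impI scattering_time_le_suminf, blast)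

text \<open>A finite expectation makes the number of unscattered rounds, and with it the scattering
  time, finite almost surely.\<close>

lemma scattering_SA:
  assumes f: "f \<in> rate_functions" and pick: "cell_selection pick"
  shows "scattering (SA N pick f)"
  unfolding scattering_def
proof (intro allI impI)
  fix F c\<^sub>0 M
  assume F: "admissible F" and M: "execution_law (SA N pick f) F c\<^sub>0 M"
  have "AE \<omega> in M. (\<Sum>t. indicator {t. \<not> distinct (\<omega> t)} t :: ennreal) \<noteq> \<infinity>"
  proof (rule nn_integral_PInf_AE)
    show "(\<integral>\<^sup>+\<omega>. (\<Sum>t. indicator {t. \<not> distinct (\<omega> t)} t) \<partial>M) \<noteq> \<infinity>"
      using expected_rounds_not_distinct_le(2)[OF f pick F M]
      by (auto simp: top_unique ennreal_mult_eq_top_iff)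
  qed (rule expected_rounds_not_distinct_le(1)[OF f pick F M])
  with AE_scattering_time_le[OF canonical_SA[OF pick] F M]
  show "AE \<omega> in M. \<forall>\<^sub>F t in sequentially. distinct (\<omega> t)"
  proof eventually_elim
    case (elim \<omega>)
    then have "scattering_time \<omega> \<noteq> \<top>" by (auto simp: top_unique)
    \<comment> \<open>The infimum over the empty set would be \<open>\<top>\<close>.\<close>
    then have "{t. \<forall>s\<ge>t. distinct (\<omega> s)} \<noteq> {}"
      by (intro notI) (simp add: scattering_time_def)
    then show ?case by (auto simp: eventually_sequentially)
  qed
qed

theorem theorem5:
  fixes f :: "nat \<Rightarrow> nat" and N :: nat
    and pick :: "point set \<Rightarrow> point \<Rightarrow> nat \<Rightarrow> point set"
  assumes "f \<in> rate_functions" and "load_constant N" and "cell_selection pick"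
  shows "canonical_scattering (SA N pick f) \<and> scatters_in_expected_bigo (SA N pick f) f"
proof
  show "canonical_scattering (SA N pick f)"
    using canonical_SA scattering_SA assms by (simp add: canonical_scattering_def)
  define g where "g n = 2 * (real (f n) + 1)" for n
  \<comment> \<open>Once \<open>1 \<le> f n\<close>, the additive constant is absorbed:
    \<open>2 * (f n + 1) \<le> 4 * f n\<close>.\<close>
  obtain n\<^sub>0 where "\<And>n. n\<^sub>0 \<le> n \<Longrightarrow> 1 \<le> f n"
    using rate_function_unbounded[OF assms(1)] by blast
  then have "eventually (\<lambda>n. norm (g n) \<le> 4 * norm (real (f n))) at_top"
    by (intro eventually_at_top_linorderI[of n\<^sub>0]) (force simp: g_def)
  then have "g \<in> O(\<lambda>n. real (f n))" by (rule bigoI)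
  moreover have "(\<integral>\<^sup>+\<omega>. scattering_time \<omega> \<partial>M) \<le> ennreal (g (length c\<^sub>0))"
    if "admissible F" "execution_law (SA N pick f) F c\<^sub>0 M" for F c\<^sub>0 M
  proof -
    have "(\<integral>\<^sup>+\<omega>. scattering_time \<omega> \<partial>M) \<le>
        (\<integral>\<^sup>+\<omega>. (\<Sum>t. indicator {t. \<not> distinct (\<omega> t)} t) \<partial>M)"
      using AE_scattering_time_le[OF canonical_SA[OF assms(3)] that] by (rule nn_integral_mono_AE)
    also have "\<dots> \<le> 2 * of_nat (potential f c\<^sub>0)"
      by (rule expected_rounds_not_distinct_le(2)[OF assms(1,3) that])
    also have "\<dots> = ennreal (2 * real (potential f c\<^sub>0))"
      by (simp add: ennreal_mult flip: ennreal_of_nat_eq_real_of_nat)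
    also have "\<dots> \<le> ennreal (g (length c\<^sub>0))"
      by (intro ennreal_leI) (auto simp: g_def potential_def)
    finally show ?thesis .
  qed
  ultimately show "scatters_in_expected_bigo (SA N pick f) f"
    unfolding scatters_in_expected_bigo_def by blast
qed

end
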